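(* Let $g(x,y)$ be the density of an $n$-dimensional Gaussian distribution $\mathcal{N}(\mu,\Lambda)$ of a pair of random vectors $(X,Y)$, with mean $\mu$ and covariance matrix $\Lambda$. Let $f(x,y)$ be the density of an arbitrary joint distribution of $(X,Y)$ on the same space, with the same mean $\mu$ and the same covariance matrix $\Lambda$, and such that the marginal distribution $f(x)$ of $X$ under $f$ is Gaussian. Then $$I_{f}[X,Y] \ \geq\ I_{g}[X,Y],$$ where $I_f[X,Y]$ and $I_g[X,Y]$ denote the mutual information of $X$ and $Y$ when $(X,Y)$ has joint density $f$ and $g$ respectively.
   Context: Here $(X,Y)$ takes values in $\mathcal{X}\times\mathcal{Y}=\mathbb{R}^{n_1}\times\mathbb{R}^{n_2}$ with $n_1+n_2=n$, and joint distributions are taken to have densities with respect to Lebesgue measure (so in particular $\Lambda$ is positive definite). For a joint density $p_{X,Y}$ with marginal densities $p_X$, $p_Y$, the mutual information is the Kullback–Leibler divergence between the joint distribution and the product of the marginals, $$I_p[X,Y]=D_{KL}(P_{(X,Y)}\,\|\,P_X\otimes P_Y)=\int_{\mathcal{X}}\int_{\mathcal{Y}} p_{X,Y}(x,y)\log\left(\frac{p_{X,Y}(x,y)}{p_X(x)\,p_Y(y)}\right)dx\,dy\in[0,\infty].$$ *)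

theory Defs
  imports "HOL-Probability.Probability"
begin

definition prob_density :: "('a::euclidean_space \<Rightarrow> real) \<Rightarrow> bool" where
  "prob_density p \<longleftrightarrow>
     p \<in> borel_measurable borel \<and> (\<forall>z. 0 \<le> p z) \<and> prob_space (density lborel (\<lambda>z. ennreal (p z)))"

definition marginal_fst :: "('a::euclidean_space \<times> 'b::euclidean_space \<Rightarrow> real) \<Rightarrow> 'a \<Rightarrow> real" where
  "marginal_fst p x = (\<integral>y. p (x, y) \<partial>lborel)"

definition marginal_snd :: "('a::euclidean_space \<times> 'b::euclidean_space \<Rightarrow> real) \<Rightarrow> 'b \<Rightarrow> real" where
  "marginal_snd p y = (\<integral>x. p (x, y) \<partial>lborel)"

(* Integral with values in [-\<infinity>, \<infinity>], as positive part minus negative part. The Bochner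
   integral is unsuitable for quantities that may be infinite, as it is 0 for every
   non-integrable function. *)
definition extended_integral :: "'a measure \<Rightarrow> ('a \<Rightarrow> real) \<Rightarrow> ereal" where
  "extended_integral M h =
     enn2ereal (\<integral>\<^sup>+ z. ennreal (h z) \<partial>M) - enn2ereal (\<integral>\<^sup>+ z. ennreal (- h z) \<partial>M)"

(* The conventions 0 * ln 0 = 0 and p * ln (p / 0) = 0 are those of HOL's division and ln; the
   second one only matters on a null set. The negative part of the integrand always has a finite
   integral (mutual_info_neg_part below), so the difference in extended_integral is never
   \<infinity> - \<infinity>. *)
definition mutual_info :: "('a::euclidean_space \<times> 'b::euclidean_space \<Rightarrow> real) \<Rightarrow> ereal" where
  "mutual_info p = extended_integral lborel
     (\<lambda>(x, y). p (x, y) * ln (p (x, y) / (marginal_fst p x * marginal_snd p y)))"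

definition pos_def_matrix :: "real ^ 'k ^ 'k \<Rightarrow> bool" where
  "pos_def_matrix A \<longleftrightarrow> transpose A = A \<and> (\<forall>v. v \<noteq> 0 \<longrightarrow> 0 < v \<bullet> (A *v v))"

definition mvn_density :: "real ^ 'k \<Rightarrow> real ^ 'k ^ 'k \<Rightarrow> real ^ 'k \<Rightarrow> real" where
  "mvn_density \<mu> \<Lambda> z =
     exp (- ((z - \<mu>) \<bullet> (matrix_inv \<Lambda> *v (z - \<mu>))) / 2) / sqrt ((2 * pi) ^ CARD('k) * det \<Lambda>)"

definition gaussian_density :: "(real ^ 'k \<Rightarrow> real) \<Rightarrow> bool" where
  "gaussian_density p \<longleftrightarrow>
     (\<exists>m S. pos_def_matrix S \<and> (AE x in lborel. p x = mvn_density m S x))"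

(* Identifies R^n1 x R^n2 with R^(n1 + n2), whose coordinates are indexed by the sum type. *)
definition stack :: "(real ^ 'n) \<times> (real ^ 'm) \<Rightarrow> real ^ ('n + 'm)" where
  "stack z = (\<chi> k. case k of Inl i \<Rightarrow> fst z $ i | Inr j \<Rightarrow> snd z $ j)"

definition has_mean :: "((real ^ 'n) \<times> (real ^ 'm) \<Rightarrow> real) \<Rightarrow> real ^ ('n + 'm) \<Rightarrow> bool" where
  "has_mean p \<mu> \<longleftrightarrow> has_bochner_integral lborel (\<lambda>z. p z *\<^sub>R stack z) \<mu>"

(* The matrix of second moments about \<mu>, all of them finite; it is the covariance matrix when \<mu>
   is the mean. *)
definition has_covariance ::
  "((real ^ 'n) \<times> (real ^ 'm) \<Rightarrow> real) \<Rightarrow> real ^ ('n + 'm) \<Rightarrow> real ^ ('n + 'm) ^ ('n + 'm) \<Rightarrow> bool"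
where
  "has_covariance p \<mu> \<Lambda> \<longleftrightarrow>
     (\<forall>i j. has_bochner_integral lborel
        (\<lambda>z. p z * ((stack z $ i - \<mu> $ i) * (stack z $ j - \<mu> $ j))) (\<Lambda> $ i $ j))"

lemma ennreal_integral_le_nn_integral:
  assumes "\<And>z. 0 \<le> (h z :: real)"
  shows "ennreal (\<integral>z. h z \<partial>M) \<le> (\<integral>\<^sup>+ z. ennreal (h z) \<partial>M)"
  using assms by (cases "integrable M h") (simp_all add: nn_integral_eq_integral not_integrable_integral_eq)

lemma mutual_info_neg_part:
  fixes p :: "'a::euclidean_space \<times> 'b::euclidean_space \<Rightarrow> real"
  assumes "prob_density p"
  shows "(\<integral>\<^sup>+ z. ennreal (- (case z of (x, y) \<Rightarrow>
           p (x, y) * ln (p (x, y) / (marginal_fst p x * marginal_snd p y)))) \<partial>lborel) \<le> 1"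
proof -
  have [measurable]: "p \<in> borel_measurable borel" and nn: "\<And>z. 0 \<le> p z"
    using assms by (auto simp: prob_density_def)
  have [measurable]: "p \<in> borel_measurable (borel \<Otimes>\<^sub>M borel)"
    by (simp add: borel_prod)
  have one: "(\<integral>\<^sup>+ z. ennreal (p z) \<partial>(lborel \<Otimes>\<^sub>M lborel)) = 1"
    using assms prob_space.emeasure_space_1[of "density lborel (\<lambda>z. ennreal (p z))"]
    by (simp add: prob_density_def emeasure_density lborel_prod)
  have [measurable]: "marginal_fst p \<in> borel_measurable borel" "marginal_snd p \<in> borel_measurable borel"
    unfolding marginal_fst_def[abs_def] marginal_snd_def[abs_def] by measurable
  have m0: "0 \<le> marginal_fst p x" "0 \<le> marginal_snd p y" for x y
    by (auto simp: marginal_fst_def marginal_snd_def nn)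
  have "(\<integral>\<^sup>+ x. ennreal (marginal_fst p x) \<partial>lborel) \<le> (\<integral>\<^sup>+ x. \<integral>\<^sup>+ y. ennreal (p (x, y)) \<partial>lborel \<partial>lborel)"
    unfolding marginal_fst_def
    by (intro nn_integral_mono ennreal_integral_le_nn_integral nn)
  also have "\<dots> = 1"
    using one by (subst lborel.nn_integral_fst) auto
  finally have 1: "(\<integral>\<^sup>+ x. ennreal (marginal_fst p x) \<partial>lborel) \<le> 1" .
  have "(\<integral>\<^sup>+ y. ennreal (marginal_snd p y) \<partial>lborel) \<le> (\<integral>\<^sup>+ y. \<integral>\<^sup>+ x. ennreal (p (x, y)) \<partial>lborel \<partial>lborel)"
    unfolding marginal_snd_def
    by (intro nn_integral_mono ennreal_integral_le_nn_integral nn)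
  also have "\<dots> = 1"
    using one by (subst lborel_pair.nn_integral_snd) auto
  finally have 2: "(\<integral>\<^sup>+ y. ennreal (marginal_snd p y) \<partial>lborel) \<le> 1" .
  have key: "- (a * ln (a / b)) \<le> b" if "0 \<le> a" "0 \<le> b" for a b :: real
  proof (cases "a = 0 \<or> b = 0")
    case False
    hence ab: "0 < a" "0 < b" using that by auto
    have "ln (b / a) \<le> b / a - 1" using ab by (intro ln_le_minus_one) auto
    hence "a * ln (b / a) \<le> a * (b / a - 1)" using ab by (intro mult_left_mono) auto
    thus ?thesis using ab by (simp add: ln_div algebra_simps)
  qed (use that in auto)
  have "(\<integral>\<^sup>+ z. ennreal (- (case z of (x, y) \<Rightarrow>
           p (x, y) * ln (p (x, y) / (marginal_fst p x * marginal_snd p y)))) \<partial>lborel)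
       \<le> (\<integral>\<^sup>+ z. ennreal (marginal_fst p (fst z)) * ennreal (marginal_snd p (snd z)) \<partial>(lborel \<Otimes>\<^sub>M lborel))"
    unfolding lborel_prod
    by (intro nn_integral_mono)
       (auto simp: m0 nn simp flip: ennreal_mult intro!: ennreal_leI key split: prod.split)
  also have "\<dots> = (\<integral>\<^sup>+ x. ennreal (marginal_fst p x) \<partial>lborel) * (\<integral>\<^sup>+ y. ennreal (marginal_snd p y) \<partial>lborel)"
    by (subst lborel.nn_integral_fst[symmetric])
       (simp_all add: nn_integral_cmult nn_integral_multc)
  also have "\<dots> \<le> 1 * 1" by (intro mult_mono 1 2) auto
  finally show ?thesis by simp
qed

end

theory Submission
  imports Defs
begin

text \<open>
  The Gaussian marginals of $f$ and $g$ on $X$ have the same first and second moments, and the log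
  ratio $\ln (f_X / g_X)$ is a quadratic polynomial, so $\int (f_X - g_X) \ln (f_X / g_X) = 0$;
  the integrand is nonnegative, hence $f_X = g_X$ almost everywhere. With
  $q(x,y) = \ln (g(x,y) / (g_X(x) g_Y(y)))$, Gibbs' inequality for $f$ against the density
  $g(x \mid y) f_Y(y)$ becomes $I_f \geq \int f q$. Since $q$ is again a quadratic polynomial,
  $\int f q = \int g q = I_g$.
\<close>

subsection \<open>Extended integrals and densities\<close>

text \<open>When all terms are finite, I_f = int f q + D(f || g(x|y) f_Y) - D(f_X || g_X). The last
  term has the wrong sign, and f_X = g_X is what removes it; f_Y sits both in I_f and in the
  reference density g(x|y) f_Y and cancels, so it may be arbitrary. The obstacle is that I_f can be
  infinite, so this identity cannot simply be integrated and rearranged. Gibbs' inequality is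
  therefore used pointwise, as ln x <= x - 1, against an integrable lower bound. No Gaussian
  integral is ever evaluated. Normalising constants are known only through total mass 1, which
  already makes them positive, and the moments of a Gaussian come from translation invariance of
  Lebesgue measure. The argument lives on abstract Euclidean spaces with a covariance operator;
  matrices and coordinates enter only at the end.\<close>

lemma extended_integral_mono_AE:
  assumes "AE z in M. h z \<le> l z"
  shows "extended_integral M h \<le> extended_integral M l"
  unfolding extended_integral_def
  using assms
  by (intro ereal_minus_mono) (auto simp: less_eq_ennreal.rep_eq[symmetric] intro!: nn_integral_mono_AE ennreal_leI elim!: AE_mp)

lemma extended_integral_eq_integral:
  assumes "integrable M h"
  shows "extended_integral M h = ereal (\<integral>z. h z \<partial>M)"
proof -
  have fin: "(\<integral>\<^sup>+ z. ennreal (h z) \<partial>M) < \<infinity>" "(\<integral>\<^sup>+ z. ennreal (- h z) \<partial>M) < \<infinity>"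
    using assms by (auto simp: real_integrable_def less_top)
  obtain a b where ab: "0 \<le> a" "(\<integral>\<^sup>+ z. ennreal (h z) \<partial>M) = ennreal a"
      "0 \<le> b" "(\<integral>\<^sup>+ z. ennreal (- h z) \<partial>M) = ennreal b"
    using fin by (cases "\<integral>\<^sup>+ z. ennreal (h z) \<partial>M"; cases "\<integral>\<^sup>+ z. ennreal (- h z) \<partial>M") auto
  then show ?thesis
    unfolding extended_integral_def real_lebesgue_integral_def[OF assms]
    by (simp add: enn2ereal_ennreal)
qed

lemma AE_lborel_fst:
  assumes "AE x in (lborel :: 'a::euclidean_space measure). Q x"
  shows "AE z in (lborel :: ('a \<times> 'b::euclidean_space) measure). Q (fst z)"
proof -
  obtain N where N: "{x \<in> space lborel. \<not> Q x} \<subseteq> N" "emeasure lborel N = 0" "N \<in> sets lborel"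
    using assms by (rule AE_E)
  \<comment> \<open>The strip over \<open>N\<close> has measure 0 * infinity, which is 0 in
    \<open>ennreal\<close>.\<close>
  have "N \<times> (UNIV::'b set) \<in> null_sets (lborel \<Otimes>\<^sub>M lborel)"
    using N by (intro null_setsI) (auto simp: lborel.emeasure_pair_measure_Times)
  then show ?thesis
    unfolding lborel_prod by (rule AE_I') (use N in auto)
qed

lemma AE_lborel_snd:
  assumes "AE y in (lborel :: 'b::euclidean_space measure). Q y"
  shows "AE z in (lborel :: ('a::euclidean_space \<times> 'b) measure). Q (snd z)"
proof -
  obtain N where N: "{x \<in> space lborel. \<not> Q x} \<subseteq> N" "emeasure lborel N = 0" "N \<in> sets lborel"
    using assms by (rule AE_E)
  have "(UNIV::'a set) \<times> N \<in> null_sets (lborel \<Otimes>\<^sub>M lborel)"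
    using N by (intro null_setsI) (auto simp: lborel.emeasure_pair_measure_Times)
  then show ?thesis
    unfolding lborel_prod by (rule AE_I') (use N in auto)
qed

lemma prob_density_measurable: "prob_density p \<Longrightarrow> p \<in> borel_measurable borel"
  and prob_density_nonneg: "prob_density p \<Longrightarrow> 0 \<le> p z"
  by (auto simp: prob_density_def)

lemma prob_density_nn_integral:
  assumes "prob_density p" shows "(\<integral>\<^sup>+ z. ennreal (p z) \<partial>lborel) = 1"
  using assms prob_space.emeasure_space_1[of "density lborel (\<lambda>z. ennreal (p z))"]
  by (simp add: prob_density_def emeasure_density)

lemma prob_density_has_integral:
  assumes "prob_density p" shows "has_bochner_integral lborel p 1"
  using prob_density_nn_integral[OF assms] prob_density_measurable[OF assms] prob_density_nonneg[OF assms]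
  by (intro has_bochner_integral_nn_integral) auto

subsection \<open>Moments from the moment generating function\<close>

text \<open>In the addition formula for sinh both cosh factors are at least 1, so sinh is
  superadditive on the nonnegative axis.\<close>

lemma sinh_real_mult_le:
  fixes x :: real
  assumes "0 \<le> x"
  shows "real n * sinh x \<le> sinh (real n * x)"
proof (induction n)
  case (Suc n)
  have "1 * sinh x \<le> cosh (real n * x) * sinh x"
    using assms by (intro mult_right_mono) (auto simp: cosh_real_ge_1)
  moreover have "sinh (real n * x) * 1 \<le> sinh (real n * x) * cosh x"
    using assms by (intro mult_left_mono) (auto simp: cosh_real_ge_1)
  moreover have "sinh (real (Suc n) * x) = sinh (real n * x) * cosh x + cosh (real n * x) * sinh x"
    by (simp add: ring_distribs sinh_add add.commute)
  ultimately show ?case using Suc by (simp add: algebra_simps)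
qed simp

text \<open>The previous bound at |x| / (n + 1), with oddness of sinh for negative x. It provides
  one dominating function for all n.\<close>

lemma abs_sinh_scaled_le:
  fixes x :: real
  shows "\<bar>real (Suc n) * sinh (x / real (Suc n))\<bar> \<le> \<bar>sinh x\<bar>"
proof -
  have *: "real (Suc n) * sinh (y / real (Suc n)) \<le> sinh y" if "0 \<le> y" for y
    using sinh_real_mult_le[of "y / real (Suc n)" "Suc n"] that by simp
  show ?thesis
  proof (cases "0 \<le> x")
    case True
    then show ?thesis using *[of x] by (simp add: abs_mult)
  next
    case False
    then show ?thesis using *[of "-x"] by (simp add: abs_mult abs_of_neg divide_neg_pos)
  qed
qed

text \<open>The difference quotient at 0 of t \<mapsto> sinh (x t), sampled at t = 1 / (n +
  1).\<close>

lemma sinh_scaled_tendsto: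
  fixes x :: real
  shows "(\<lambda>n. real (Suc n) * sinh (x / real (Suc n))) \<longlonglongrightarrow> x"
proof -
  have "((\<lambda>t. sinh (x * t) / t) \<longlongrightarrow> x) (at (0::real))"
  proof -
    have "((\<lambda>t. sinh (x * t)) has_real_derivative x) (at 0)"
      by (auto intro!: derivative_eq_intros)
    then show ?thesis by (simp add: DERIV_def)
  qed
  moreover have "filterlim (\<lambda>n. 1 / real (Suc n)) (at 0) sequentially"
    unfolding filterlim_at using LIMSEQ_inverse_real_of_nat by (auto simp: field_simps)
  ultimately have "((\<lambda>n. sinh (x * (1 / real (Suc n))) / (1 / real (Suc n))) \<longlonglongrightarrow> x)"
    by (rule filterlim_compose)
  then show ?thesis by (simp add: mult.commute)
qed

text \<open>
  \<open>n sinh (W / n)\<close> tends to \<open>W\<close> and is dominated by \<open>sinh W\<close>, and the integrals of it and of its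
  square are given by the moment generating function.
\<close>

lemma moments_of_gaussian_mgf:
  fixes p W :: "'a \<Rightarrow> real"
  assumes [measurable]: "p \<in> borel_measurable M" "W \<in> borel_measurable M"
    and mgf: "\<And>t. has_bochner_integral M (\<lambda>z. p z * exp (t * W z)) (exp (t\<^sup>2 * s / 2))"
  shows "has_bochner_integral M (\<lambda>z. p z * W z) 0"
    and "has_bochner_integral M (\<lambda>z. p z * (W z)\<^sup>2) s"
proof -
  define S where "S n z = real (Suc n) * sinh (W z / real (Suc n))" for n z
  have S_le: "\<bar>S n z\<bar> \<le> \<bar>sinh (W z)\<bar>" for n z
    unfolding S_def by (rule abs_sinh_scaled_le)
  have S_lim: "(\<lambda>n. S n z) \<longlonglongrightarrow> W z" for z
    unfolding S_def by (rule sinh_scaled_tendsto)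
  \<comment> \<open>The prescribed generating function is even in \<open>t\<close>, so the odd part
    of the exponential integrates to exactly 0.\<close>
  have p_sinh: "has_bochner_integral M (\<lambda>z. p z * sinh (t * W z)) 0" for t
  proof -
    have "has_bochner_integral M (\<lambda>z. (p z * exp (t * W z) - p z * exp ((-t) * W z)) / 2)
        ((exp (t\<^sup>2 * s / 2) - exp ((-t)\<^sup>2 * s / 2)) / 2)"
      by (intro has_bochner_integral_divide has_bochner_integral_diff mgf)
    then show ?thesis by (simp add: sinh_def algebra_simps diff_divide_distrib)
  qed
  \<comment> \<open>sinh^2 is a combination of exponentials at 2t, -2t and 0; the constant is kept
    as \<open>exp (0 * W z)\<close> so that the generating function at 0 supplies the total mass of
    \<open>p\<close>.\<close>
  have p_sinh2: "has_bochner_integral M (\<lambda>z. p z * (sinh (t * W z))\<^sup>2) ((exp (2 * t\<^sup>2 * s) - 1) / 2)" for t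
  proof -
    have "has_bochner_integral M
        (\<lambda>z. (p z * exp ((2 * t) * W z) + p z * exp ((-2 * t) * W z) - 2 * (p z * exp (0 * W z))) / 4)
        ((exp ((2 * t)\<^sup>2 * s / 2) + exp ((-2 * t)\<^sup>2 * s / 2) - 2 * exp (0\<^sup>2 * s / 2)) / 4)"
      by (intro has_bochner_integral_divide has_bochner_integral_diff has_bochner_integral_add
            has_bochner_integral_mult_right mgf)
    moreover have "p z * (sinh (t * W z))\<^sup>2 =
        (p z * exp ((2 * t) * W z) + p z * exp ((-2 * t) * W z) - 2 * (p z * exp (0 * W z))) / 4" for z
    proof -
      have "exp (t * W z) * exp (- (t * W z)) = 1" by (simp flip: exp_add)
      then have "(sinh (t * W z))\<^sup>2 = ((exp (t * W z))\<^sup>2 + (exp (- (t * W z)))\<^sup>2 - 2) / 4"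
        by (simp add: sinh_def power2_eq_square field_simps)
      then have sq: "(sinh (t * W z))\<^sup>2 = (exp ((2 * t) * W z) + exp ((-2 * t) * W z) - 2) / 4"
        by (simp add: mult_ac flip: exp_double)
      show ?thesis unfolding sq by (simp add: algebra_simps diff_divide_distrib add_divide_distrib)
    qed
    moreover have "(exp (2 * t\<^sup>2 * s) - 1) / 2 =
        (exp ((2 * t)\<^sup>2 * s / 2) + exp ((-2 * t)\<^sup>2 * s / 2) - 2 * exp (0\<^sup>2 * s / 2)) / 4"
      by (simp add: power2_eq_square field_simps)
    ultimately show ?thesis by (simp only:)
  qed
  \<comment> \<open>\<open>p\<close> may change sign, so the dominating function carries |p|; its
    integrability is that of p sinh W in absolute value.\<close>
  have bound1: "integrable M (\<lambda>z. \<bar>p z\<bar> * \<bar>sinh (W z)\<bar>)"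
    using integrable_abs[of M "\<lambda>z. p z * sinh (W z)"] p_sinh[of 1]
    by (simp add: has_bochner_integral_iff abs_mult)
  have S_int: "has_bochner_integral M (\<lambda>z. p z * S n z) 0" for n
    using has_bochner_integral_mult_right[OF p_sinh[of "1 / real (Suc n)"], of "real (Suc n)"]
    by (simp add: S_def mult.left_commute)
  have dc1: "integrable M (\<lambda>z. p z * W z)" "(\<lambda>n. \<integral>z. p z * S n z \<partial>M) \<longlonglongrightarrow> (\<integral>z. p z * W z \<partial>M)"
  proof -
    have m: "(\<lambda>z. p z * S n z) \<in> borel_measurable M" for n
      using S_int[of n] by (auto simp: has_bochner_integral_iff)
    show "integrable M (\<lambda>z. p z * W z)"
      by (rule integrable_dominated_convergence[where w = "\<lambda>z. \<bar>p z\<bar> * \<bar>sinh (W z)\<bar>" and s = "\<lambda>n z. p z * S n z"])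
         (auto intro!: m bound1 tendsto_intros S_lim mult_left_mono S_le simp: abs_mult)
    show "(\<lambda>n. \<integral>z. p z * S n z \<partial>M) \<longlonglongrightarrow> (\<integral>z. p z * W z \<partial>M)"
      by (rule integral_dominated_convergence[where w = "\<lambda>z. \<bar>p z\<bar> * \<bar>sinh (W z)\<bar>" and s = "\<lambda>n z. p z * S n z"])
         (auto intro!: m bound1 tendsto_intros S_lim mult_left_mono S_le simp: abs_mult)
  qed
  have "(\<integral>z. p z * W z \<partial>M) = 0"
    using dc1(2) S_int by (auto simp: has_bochner_integral_iff LIMSEQ_const_iff)
  with dc1(1) show "has_bochner_integral M (\<lambda>z. p z * W z) 0"
    by (simp add: has_bochner_integral_iff)

  have bound2: "integrable M (\<lambda>z. \<bar>p z\<bar> * (sinh (W z))\<^sup>2)"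
    using integrable_abs[of M "\<lambda>z. p z * (sinh (W z))\<^sup>2"] p_sinh2[of 1]
    by (simp add: has_bochner_integral_iff abs_mult)
  have S2_int: "has_bochner_integral M (\<lambda>z. p z * (S n z)\<^sup>2)
      ((real (Suc n))\<^sup>2 * ((exp (2 * (1 / real (Suc n))\<^sup>2 * s) - 1) / 2))" for n
    using has_bochner_integral_mult_right[OF p_sinh2[of "1 / real (Suc n)"], of "(real (Suc n))\<^sup>2"]
    by (simp add: S_def mult.left_commute power_mult_distrib)
  have m: "(\<lambda>z. p z * (S n z)\<^sup>2) \<in> borel_measurable M" for n
    using S2_int[of n] by (auto simp: has_bochner_integral_iff)
  have S2_le: "(S n z)\<^sup>2 \<le> (sinh (W z))\<^sup>2" for n z
    using S_le[of n z] by (simp add: abs_le_square_iff)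
  have i2: "integrable M (\<lambda>z. p z * (W z)\<^sup>2)"
    by (rule integrable_dominated_convergence[where w = "\<lambda>z. \<bar>p z\<bar> * (sinh (W z))\<^sup>2" and s = "\<lambda>n z. p z * (S n z)\<^sup>2"])
       (auto intro!: m bound2 tendsto_intros S_lim mult_left_mono S2_le simp: abs_mult)
  have "(\<lambda>n. \<integral>z. p z * (S n z)\<^sup>2 \<partial>M) \<longlonglongrightarrow> (\<integral>z. p z * (W z)\<^sup>2 \<partial>M)"
    by (rule integral_dominated_convergence[where w = "\<lambda>z. \<bar>p z\<bar> * (sinh (W z))\<^sup>2" and s = "\<lambda>n z. p z * (S n z)\<^sup>2"])
       (auto intro!: m bound2 tendsto_intros S_lim mult_left_mono S2_le simp: abs_mult)
  then have l1: "(\<lambda>n. (real (Suc n))\<^sup>2 * ((exp (2 * (1 / real (Suc n))\<^sup>2 * s) - 1) / 2)) \<longlonglongrightarrow> (\<integral>z. p z * (W z)\<^sup>2 \<partial>M)"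
    by (simp only: has_bochner_integral_integral_eq[OF S2_int])
  \<comment> \<open>In u = 1 / (n + 1)^2 this is the difference quotient at 0 of (exp (2us) - 1) /
    2, whose derivative there is \<open>s\<close>.\<close>
  have l2: "(\<lambda>n. (real (Suc n))\<^sup>2 * ((exp (2 * (1 / real (Suc n))\<^sup>2 * s) - 1) / 2)) \<longlonglongrightarrow> s"
  proof -
    have "((\<lambda>u. (exp (2 * u * s) - 1) / 2) has_real_derivative s) (at 0)"
      by (auto intro!: derivative_eq_intros)
    then have "((\<lambda>u. ((exp (2 * u * s) - 1) / 2) / u) \<longlongrightarrow> s) (at 0)" by (simp add: DERIV_def)
    moreover have "filterlim (\<lambda>n. (1 / real (Suc n))\<^sup>2) (at 0) sequentially"
      unfolding filterlim_at using tendsto_power[OF LIMSEQ_inverse_real_of_nat, of 2] by (auto simp: field_simps)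
    ultimately have "(\<lambda>n. ((exp (2 * (1 / real (Suc n))\<^sup>2 * s) - 1) / 2) / (1 / real (Suc n))\<^sup>2) \<longlonglongrightarrow> s"
      by (rule filterlim_compose)
    then show ?thesis by (simp add: power_divide mult.commute)
  qed
  show "has_bochner_integral M (\<lambda>z. p z * (W z)\<^sup>2) s"
    using i2 LIMSEQ_unique[OF l1 l2] by (simp add: has_bochner_integral_iff)
qed

subsection \<open>Densities with the same moments\<close>

text \<open>Integrability is part of the notion because a Bochner integral defaults to 0; with it,
  the admissible \<open>h\<close> form a vector space, and a polynomial can be checked monomial by
  monomial.\<close>

definition same_expectation :: "('c::euclidean_space \<Rightarrow> real) \<Rightarrow> ('c \<Rightarrow> real) \<Rightarrow> ('c \<Rightarrow> real) \<Rightarrow> bool" where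
  "same_expectation f g h \<longleftrightarrow>
     integrable lborel (\<lambda>z. f z * h z) \<and> integrable lborel (\<lambda>z. g z * h z) \<and>
     (\<integral>z. f z * h z \<partial>lborel) = (\<integral>z. g z * h z \<partial>lborel)"

lemma same_expectation_add:
  assumes "same_expectation f g h" "same_expectation f g l"
  shows "same_expectation f g (\<lambda>z. h z + l z)"
  using assms by (auto simp: same_expectation_def ring_distribs)

lemma same_expectation_cmult:
  assumes "same_expectation f g h"
  shows "same_expectation f g (\<lambda>z. c * h z)"
proof -
  have *: "p * (c * q) = c * (p * q)" for p q :: real by simp
  show ?thesis using assms by (simp add: same_expectation_def *)
qed

lemma same_expectation_diff:
  assumes "same_expectation f g h" "same_expectation f g l"
  shows "same_expectation f g (\<lambda>z. h z - l z)"
  using same_expectation_add[OF assms(1) same_expectation_cmult[OF assms(2), of "-1"]] by simp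

lemma same_expectation_sum:
  assumes "\<And>i. i \<in> I \<Longrightarrow> same_expectation f g (h i)"
  shows "same_expectation f g (\<lambda>z. \<Sum>i\<in>I. h i z)"
  using assms
  by (auto simp: same_expectation_def sum_distrib_left Bochner_Integration.integral_sum intro!: sum.cong)

text \<open>Agreement up to order two, order zero included: equal total mass is what lets constants
  and a change of centre be handled.\<close>

definition same_moments :: "'c::euclidean_space \<Rightarrow> ('c \<Rightarrow> real) \<Rightarrow> ('c \<Rightarrow> real) \<Rightarrow> bool" where
  "same_moments \<mu> f g \<longleftrightarrow>
     same_expectation f g (\<lambda>_. 1) \<and>
     (\<forall>i\<in>Basis. same_expectation f g (\<lambda>z. (z - \<mu>) \<bullet> i)) \<and>
     (\<forall>i\<in>Basis. \<forall>j\<in>Basis. same_expectation f g (\<lambda>z. ((z - \<mu>) \<bullet> i) * ((z - \<mu>) \<bullet> j)))"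

lemma same_moments_const:
  assumes "same_moments \<mu> f g"
  shows "same_expectation f g (\<lambda>_. k)"
  using assms same_expectation_cmult[of f g "\<lambda>_. 1" k] by (simp add: same_moments_def)

lemma same_moments_linear:
  assumes "same_moments \<mu> f g"
  shows "same_expectation f g (\<lambda>z. (z - \<mu>) \<bullet> v)"
proof -
  have "same_expectation f g (\<lambda>z. \<Sum>i\<in>Basis. (v \<bullet> i) * ((z - \<mu>) \<bullet> i))"
    using assms by (intro same_expectation_sum same_expectation_cmult) (auto simp: same_moments_def)
  then show ?thesis
    by (subst euclidean_inner) (simp add: mult.commute)
qed

lemma same_moments_quadratic:
  assumes "same_moments \<mu> f g" "linear L"
  shows "same_expectation f g (\<lambda>z. (z - \<mu>) \<bullet> L (z - \<mu>))"
proof -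
  have "same_expectation f g (\<lambda>z. \<Sum>i\<in>Basis. \<Sum>j\<in>Basis. (L i \<bullet> j) * (((z - \<mu>) \<bullet> i) * ((z - \<mu>) \<bullet> j)))"
    using assms by (intro same_expectation_sum same_expectation_cmult) (auto simp: same_moments_def)
  moreover have "w \<bullet> L w = (\<Sum>i\<in>Basis. \<Sum>j\<in>Basis. (L i \<bullet> j) * ((w \<bullet> i) * (w \<bullet> j)))" for w
  proof -
    have "L w = L (\<Sum>i\<in>Basis. (w \<bullet> i) *\<^sub>R i)"
      by (simp only: euclidean_representation)
    also have "\<dots> = (\<Sum>i\<in>Basis. (w \<bullet> i) *\<^sub>R L i)"
      using assms(2) by (simp add: linear_sum linear_cmul)
    finally have "w \<bullet> L w = (\<Sum>i\<in>Basis. (w \<bullet> i) * (w \<bullet> L i))"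
      by (simp add: inner_sum_right)
    also have "\<dots> = (\<Sum>i\<in>Basis. \<Sum>j\<in>Basis. (L i \<bullet> j) * ((w \<bullet> i) * (w \<bullet> j)))"
      by (subst (2) euclidean_inner) (simp add: sum_distrib_left mult_ac)
    finally show ?thesis .
  qed
  ultimately show ?thesis by simp
qed

text \<open>The Gaussian marginal of \<open>f\<close> comes with its own centre, not known in
  advance to be the mean. Expanding around \<mu> leaves a quadratic, a linear and a constant term;
  the adjoint appears because \<open>L\<close> need not be symmetric.\<close>

lemma same_moments_quadratic_shifted:
  assumes "same_moments \<mu> f g" "linear L"
  shows "same_expectation f g (\<lambda>z. (z - m) \<bullet> L (z - m))"
proof -
  have adj: "w \<bullet> adjoint L v = L w \<bullet> v" for v w
    using adjoint_works[OF assms(2)] by simp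
  have "(\<lambda>z. (z - m) \<bullet> L (z - m)) = (\<lambda>z. (z - \<mu>) \<bullet> L (z - \<mu>) +
      (z - \<mu>) \<bullet> (L (\<mu> - m) + adjoint L (\<mu> - m)) + (\<mu> - m) \<bullet> L (\<mu> - m))"
  proof
    fix z
    have "z - m = (z - \<mu>) + (\<mu> - m)" by simp
    then have "(z - m) \<bullet> L (z - m) = ((z - \<mu>) + (\<mu> - m)) \<bullet> (L (z - \<mu>) + L (\<mu> - m))"
      using linear_add[OF assms(2)] by metis
    then show "(z - m) \<bullet> L (z - m) = (z - \<mu>) \<bullet> L (z - \<mu>) +
        (z - \<mu>) \<bullet> (L (\<mu> - m) + adjoint L (\<mu> - m)) + (\<mu> - m) \<bullet> L (\<mu> - m)"
      by (simp only: inner_add_left inner_add_right adj inner_commute[of "\<mu> - m" "L (z - \<mu>)"])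
  qed
  then show ?thesis
    by (simp only:) (intro same_expectation_add same_moments_quadratic[OF assms(1)] same_moments_linear[OF assms(1)]
      same_moments_const[OF assms(1)] assms(2))
qed

subsection \<open>Gaussian densities and their marginals\<close>

lemma lborel_integral_translate:
  fixes h :: "'c::euclidean_space \<Rightarrow> real"
  assumes [measurable]: "h \<in> borel_measurable borel"
  shows "(\<integral>y. h (t + y) \<partial>lborel) = (\<integral>y. h y \<partial>lborel)"
  using integral_distr[of "(+) t" lborel borel h] by (simp add: lborel_distr_plus)

lemma has_bochner_integral_lborel_translate:
  fixes h :: "'c::euclidean_space \<Rightarrow> real"
  assumes "has_bochner_integral lborel h r"
  shows "has_bochner_integral lborel (\<lambda>y. h (t + y)) r"
  using integrable_distr_eq[of "(+) t" lborel borel h] lborel_integral_translate[of h t] assms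
  by (auto simp: lborel_distr_plus has_bochner_integral_iff)

lemma borel_measurable_linear:
  "linear L \<Longrightarrow> L \<in> borel_measurable borel" for L :: "'c::euclidean_space \<Rightarrow> 'd::euclidean_space"
  by (intro borel_measurable_continuous_onI linear_continuous_on linear_conv_bounded_linear[THEN iffD1])

text \<open>\<open>P\<close> is the precision operator, the inverse of the covariance operator \<open>A\<close>.\<close>

locale covariance_operator =
  fixes A P :: "'c::euclidean_space \<Rightarrow> 'c"
  assumes linear_A: "linear A" and linear_P: "linear P"
    and sym: "A u \<bullet> v = u \<bullet> A v"
    and pos: "v \<noteq> 0 \<Longrightarrow> 0 < v \<bullet> A v"
    and A_P [simp]: "A (P v) = v" and P_A [simp]: "P (A v) = v"
begin

text \<open>The factor \<open>c\<close> is left free: normalisation is always supplied as the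
  hypothesis that the total integral is 1, never as a formula for \<open>c\<close>.\<close>

definition gauss :: "real \<Rightarrow> 'c \<Rightarrow> 'c \<Rightarrow> real" where
  "gauss c \<mu> z = c * exp (- ((z - \<mu>) \<bullet> P (z - \<mu>)) / 2)"

lemma gauss_measurable [measurable]: "gauss c \<mu> \<in> borel_measurable borel"
proof -
  note [measurable] = borel_measurable_linear[OF linear_P]
  show ?thesis unfolding gauss_def[abs_def] by measurable
qed

text \<open>Tilting the density by an exponential only translates and rescales it.\<close>

lemma gauss_mgf:
  assumes "has_bochner_integral lborel (gauss c \<mu>) 1"
  shows "has_bochner_integral lborel (\<lambda>z. gauss c \<mu> z * exp (t * ((z - \<mu>) \<bullet> u))) (exp (t\<^sup>2 * (u \<bullet> A u) / 2))"
proof -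
  \<comment> \<open>Completing the square: with w = z - \<mu>, the exponent - (w \<bullet> P w) / 2
    + t (w \<bullet> u) is maximal at w = t A u, which dictates the translation.\<close>
  have "gauss c \<mu> z * exp (t * ((z - \<mu>) \<bullet> u)) = exp (t\<^sup>2 * (u \<bullet> A u) / 2) * gauss c \<mu> (- (t *\<^sub>R A u) + z)" for z
  proof -
    define w where "w = z - \<mu>"
    have *: "- (t *\<^sub>R A u) + z - \<mu> = w - t *\<^sub>R A u" by (simp add: w_def)
    have "P (w - t *\<^sub>R A u) = P w - t *\<^sub>R u"
      using linear_P by (simp add: linear_diff linear_cmul)
    moreover have "A u \<bullet> P w = u \<bullet> w" by (simp add: sym)
    moreover have "u \<bullet> w = w \<bullet> u" "A u \<bullet> u = u \<bullet> A u" by (simp_all add: inner_commute)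
    ultimately have "(w - t *\<^sub>R A u) \<bullet> P (w - t *\<^sub>R A u) = w \<bullet> P w - 2 * t * (w \<bullet> u) + t\<^sup>2 * (u \<bullet> A u)"
      by (simp only: inner_diff_left inner_diff_right inner_scaleR_left inner_scaleR_right)
         (simp add: power2_eq_square algebra_simps)
    then show ?thesis
      unfolding gauss_def * w_def[symmetric] by (simp add: field_simps flip: exp_add)
  qed
  then show ?thesis
    using has_bochner_integral_mult_right[OF has_bochner_integral_lborel_translate[OF assms, of "- (t *\<^sub>R A u)"], of "exp (t\<^sup>2 * (u \<bullet> A u) / 2)"]
    by simp
qed

lemma gauss_mean:
  assumes "has_bochner_integral lborel (gauss c \<mu>) 1"
  shows "has_bochner_integral lborel (\<lambda>z. gauss c \<mu> z * ((z - \<mu>) \<bullet> u)) 0"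
  by (rule moments_of_gaussian_mgf(1)[OF _ _ gauss_mgf[OF assms]]) auto

lemma gauss_variance:
  assumes "has_bochner_integral lborel (gauss c \<mu>) 1"
  shows "has_bochner_integral lborel (\<lambda>z. gauss c \<mu> z * ((z - \<mu>) \<bullet> u)\<^sup>2) (u \<bullet> A u)"
  by (rule moments_of_gaussian_mgf(2)[OF _ _ gauss_mgf[OF assms]]) auto

text \<open>Polarisation of the variances in the directions u, v and u + v; symmetry of
  \<open>A\<close> merges the two cross terms.\<close>

lemma gauss_covariance:
  assumes "has_bochner_integral lborel (gauss c \<mu>) 1"
  shows "has_bochner_integral lborel (\<lambda>z. gauss c \<mu> z * (((z - \<mu>) \<bullet> u) * ((z - \<mu>) \<bullet> v))) (u \<bullet> A v)"
proof -
  have "has_bochner_integral lborel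
      (\<lambda>z. (gauss c \<mu> z * ((z - \<mu>) \<bullet> (u + v))\<^sup>2 - gauss c \<mu> z * ((z - \<mu>) \<bullet> u)\<^sup>2 - gauss c \<mu> z * ((z - \<mu>) \<bullet> v)\<^sup>2) / 2)
      (((u + v) \<bullet> A (u + v) - u \<bullet> A u - v \<bullet> A v) / 2)"
    by (intro has_bochner_integral_divide has_bochner_integral_diff gauss_variance assms)
  moreover have "(u + v) \<bullet> A (u + v) - u \<bullet> A u - v \<bullet> A v = 2 * (u \<bullet> A v)"
    using sym[of u v] by (simp add: linear_add[OF linear_A] inner_add_left inner_add_right inner_commute)
  moreover have "(\<lambda>z. (gauss c \<mu> z * ((z - \<mu>) \<bullet> (u + v))\<^sup>2 - gauss c \<mu> z * ((z - \<mu>) \<bullet> u)\<^sup>2 - gauss c \<mu> z * ((z - \<mu>) \<bullet> v)\<^sup>2) / 2)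
      = (\<lambda>z. gauss c \<mu> z * (((z - \<mu>) \<bullet> u) * ((z - \<mu>) \<bullet> v)))"
    by (simp add: inner_add_right power2_eq_square field_simps)
  ultimately show ?thesis by simp
qed

end

text \<open>
  Completing the square: \<open>(x, L x) = A (K x, 0)\<close> is the point above \<open>x\<close> at which the exponent is
  maximal, and its image \<open>(K x, 0)\<close> under \<open>P\<close> is orthogonal to the fibre.
\<close>

lemma marginal_fst_gauss:
  fixes A P :: "'a::euclidean_space \<times> 'b::euclidean_space \<Rightarrow> 'a \<times> 'b"
  assumes "covariance_operator A P"
  obtains K k where "linear K"
    "\<And>x. marginal_fst (covariance_operator.gauss P c \<mu>) x = k * exp (- ((x - fst \<mu>) \<bullet> K (x - fst \<mu>)) / 2)"
proof -
  interpret covariance_operator A P by fact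
  \<comment> \<open>\<open>T\<close> is the covariance block of the first component. Positivity
    makes it injective, and its inverse \<open>K\<close> is the precision operator of the
    marginal.\<close>
  define T where "T u = fst (A (u, 0))" for u
  have lin0: "linear (\<lambda>u::'a. (u, 0::'b))"
    by (intro linearI) auto
  have lin_T: "linear T"
    unfolding T_def
    using linear_compose[OF linear_compose[OF lin0 linear_A] linear_fst] by (simp add: o_def)
  have "inj T"
    unfolding linear_injective_0[OF lin_T]
  proof (intro allI impI)
    fix u assume "T u = 0"
    then have "(u, 0) \<bullet> A (u, 0) = 0" by (cases "A (u, 0)") (simp add: T_def)
    then show "u = 0" using pos[of "(u, 0)"] by (auto simp: zero_prod_def)
  qed
  then obtain K where K: "linear K" "\<And>x. T (K x) = x"
    using linear_injective_isomorphism[OF lin_T] by blast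
  define L where "L x = snd (A (K x, 0))" for x
  \<comment> \<open>Once centred, every fibre contributes the same factor \<open>J\<close>. Its
    value stays unknown; the sign of \<open>c * J\<close> is settled later by normalisation.\<close>
  define J where "J = (\<integral>y. exp (- ((0, y) \<bullet> P (0, y)) / 2) \<partial>lborel)"
  have split: "(x, y) \<bullet> P (x, y) = x \<bullet> K x + (0, y - L x) \<bullet> P (0, y - L x)" for x y
  proof -
    have xy: "(x, y) = A (K x, 0) + (0, y - L x)"
      using K(2)[of x] by (simp add: T_def L_def prod_eq_iff)
    then have "P (x, y) = (K x, 0) + P (0, y - L x)"
      using linear_add[OF linear_P] P_A by metis
    then have "(x, y) \<bullet> P (x, y) = x \<bullet> K x + (x, y) \<bullet> P (0, y - L x)"
      by (simp add: inner_add_right)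
    also have "(x, y) \<bullet> P (0, y - L x) = A (K x, 0) \<bullet> P (0, y - L x) + (0, y - L x) \<bullet> P (0, y - L x)"
      by (subst xy) (simp only: inner_add_left)
    also have "A (K x, 0) \<bullet> P (0, y - L x) = 0" by (simp add: sym)
    finally show ?thesis by simp
  qed
  note [measurable] = borel_measurable_linear[OF linear_P]
  have "marginal_fst (gauss c \<mu>) x = c * J * exp (- ((x - fst \<mu>) \<bullet> K (x - fst \<mu>)) / 2)" for x
  proof -
    \<comment> \<open>The conditional mean of the second component given \<open>x\<close>;
      translating it away makes the fibre integral independent of \<open>x\<close>.\<close>
    define d where "d = snd \<mu> + L (x - fst \<mu>)"
    have "gauss c \<mu> (x, y) = c * exp (- ((x - fst \<mu>) \<bullet> K (x - fst \<mu>)) / 2) *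
        exp (- ((0, - d + y) \<bullet> P (0, - d + y)) / 2)" for y
    proof -
      have "(x, y) - \<mu> = (x - fst \<mu>, y - snd \<mu>)" by (simp add: prod_eq_iff)
      moreover have "y - snd \<mu> - L (x - fst \<mu>) = - d + y" by (simp add: d_def)
      ultimately show ?thesis
        using split[of "x - fst \<mu>" "y - snd \<mu>"] by (simp add: gauss_def field_simps flip: exp_add)
    qed
    then have "marginal_fst (gauss c \<mu>) x = c * exp (- ((x - fst \<mu>) \<bullet> K (x - fst \<mu>)) / 2) *
        (\<integral>y. exp (- ((0, - d + y) \<bullet> P (0, - d + y)) / 2) \<partial>lborel)"
      by (simp add: marginal_fst_def)
    also have "(\<integral>y. exp (- ((0, - d + y) \<bullet> P (0, - d + y)) / 2) \<partial>lborel) = J"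
      unfolding J_def by (rule lborel_integral_translate) simp
    finally show ?thesis by simp
  qed
  with K(1) show ?thesis by (rule that)
qed

text \<open>Exchanging the components lets the second marginal be read off from the computation of
  the first.\<close>

lemma covariance_operator_swap:
  fixes A P :: "'a::euclidean_space \<times> 'b::euclidean_space \<Rightarrow> 'a \<times> 'b"
  assumes "covariance_operator A P"
  shows "covariance_operator (prod.swap \<circ> A \<circ> prod.swap) (prod.swap \<circ> P \<circ> prod.swap)"
proof -
  interpret covariance_operator A P by fact
  have swap: "linear (prod.swap :: 'c::euclidean_space \<times> 'd::euclidean_space \<Rightarrow> _)"
    by (intro linearI) auto
  have lin: "linear (prod.swap \<circ> F \<circ> prod.swap)" if "linear F" for F :: "'a \<times> 'b \<Rightarrow> 'a \<times> 'b"
    by (intro linear_compose swap that)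
  have inner_swap: "prod.swap u \<bullet> v = u \<bullet> prod.swap v"
    for u :: "'c::euclidean_space \<times> 'd::euclidean_space" and v
    by (cases u; cases v) simp
  show ?thesis
  proof (rule covariance_operator.intro)
    show "0 < v \<bullet> (prod.swap \<circ> A \<circ> prod.swap) v" if "v \<noteq> 0" for v
      using that pos[of "prod.swap v"] by (cases v) (auto simp: inner_swap[symmetric] zero_prod_def)
  qed (simp_all add: lin linear_A linear_P inner_swap sym)
qed

lemma marginal_snd_gauss:
  fixes A P :: "'a::euclidean_space \<times> 'b::euclidean_space \<Rightarrow> 'a \<times> 'b"
  assumes "covariance_operator A P"
  obtains K k where "linear K"
    "\<And>y. marginal_snd (covariance_operator.gauss P c \<mu>) y = k * exp (- ((y - snd \<mu>) \<bullet> K (y - snd \<mu>)) / 2)"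
proof -
  note swap = covariance_operator_swap[OF assms]
  have "covariance_operator.gauss (prod.swap \<circ> P \<circ> prod.swap) c (prod.swap \<mu>) (y, x) =
      covariance_operator.gauss P c \<mu> (x, y)" for x y
    unfolding covariance_operator.gauss_def[OF swap] covariance_operator.gauss_def[OF assms]
    by (cases "P ((x, y) - \<mu>)"; cases \<mu>) (auto simp: add.commute)
  then have "marginal_fst (covariance_operator.gauss (prod.swap \<circ> P \<circ> prod.swap) c (prod.swap \<mu>)) y =
      marginal_snd (covariance_operator.gauss P c \<mu>) y" for y
    by (simp add: marginal_fst_def marginal_snd_def)
  then show ?thesis
    using marginal_fst_gauss[OF swap, of c "prod.swap \<mu>"] that by (metis fst_swap)
qed

subsection \<open>Marginals of arbitrary densities\<close>

text \<open>Fubini: a function of the first component is constant on fibres and leaves the inner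
  integral.\<close>

lemma marginal_fst_expectation:
  fixes p :: "'a::euclidean_space \<times> 'b::euclidean_space \<Rightarrow> real"
  assumes "integrable lborel (\<lambda>z. p z * h (fst z))"
  shows "has_bochner_integral lborel (\<lambda>x. marginal_fst p x * h x) (\<integral>z. p z * h (fst z) \<partial>lborel)"
proof -
  have int: "integrable (lborel \<Otimes>\<^sub>M lborel) (\<lambda>z. p z * h (fst z))"
    using assms by (simp add: lborel_prod)
  show ?thesis
    using lborel_pair.integrable_fst'[OF int] lborel_pair.integral_fst'[OF int]
    by (simp add: has_bochner_integral_iff lborel_prod marginal_fst_def)
qed

lemma marginal_snd_expectation:
  fixes p :: "'a::euclidean_space \<times> 'b::euclidean_space \<Rightarrow> real"
  assumes "integrable lborel (\<lambda>z. p z * h (snd z))"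
  shows "has_bochner_integral lborel (\<lambda>y. marginal_snd p y * h y) (\<integral>z. p z * h (snd z) \<partial>lborel)"
proof -
  have int: "integrable (lborel \<Otimes>\<^sub>M lborel) (case_prod (\<lambda>x y. p (x, y) * h y))"
    using assms by (simp add: lborel_prod case_prod_beta')
  show ?thesis
    using lborel_pair.integrable_snd[OF int] lborel_pair.integral_snd[OF int]
    by (simp add: has_bochner_integral_iff lborel_prod case_prod_beta' marginal_snd_def)
qed

lemma has_bochner_integral_marginal_fst:
  fixes p :: "'a::euclidean_space \<times> 'b::euclidean_space \<Rightarrow> real"
  assumes "has_bochner_integral lborel p r"
  shows "has_bochner_integral lborel (marginal_fst p) r"
  using marginal_fst_expectation[of p "\<lambda>_. 1"] assms by (simp add: has_bochner_integral_iff)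

lemma has_bochner_integral_marginal_snd:
  fixes p :: "'a::euclidean_space \<times> 'b::euclidean_space \<Rightarrow> real"
  assumes "has_bochner_integral lborel p r"
  shows "has_bochner_integral lborel (marginal_snd p) r"
  using marginal_snd_expectation[of p "\<lambda>_. 1"] assms by (simp add: has_bochner_integral_iff)

text \<open>For densities given by a formula only almost everywhere: almost every fibre meets the
  exceptional null set in a null set.\<close>

lemma marginal_fst_cong_AE:
  fixes p r :: "'a::euclidean_space \<times> 'b::euclidean_space \<Rightarrow> real"
  assumes [measurable]: "p \<in> borel_measurable borel" "r \<in> borel_measurable borel"
    and "AE z in lborel. p z = r z"
  shows "AE x in lborel. marginal_fst p x = marginal_fst r x"
proof -
  have [measurable]: "p \<in> borel_measurable (borel \<Otimes>\<^sub>M borel)" "r \<in> borel_measurable (borel \<Otimes>\<^sub>M borel)"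
    by (simp_all add: borel_prod)
  have "AE x in lborel. AE y in lborel. p (x, y) = r (x, y)"
    using assms(3) by (rule lborel_pair.AE_pair[unfolded lborel_prod])
  then show ?thesis
    by (rule AE_mp) (auto simp: marginal_fst_def intro!: integral_cong_AE)
qed

lemma marginal_snd_cong_AE:
  fixes p r :: "'a::euclidean_space \<times> 'b::euclidean_space \<Rightarrow> real"
  assumes [measurable]: "p \<in> borel_measurable borel" "r \<in> borel_measurable borel"
    and "AE z in lborel. p z = r z"
  shows "AE y in lborel. marginal_snd p y = marginal_snd r y"
proof -
  have [measurable]: "p \<in> borel_measurable (borel \<Otimes>\<^sub>M borel)" "r \<in> borel_measurable (borel \<Otimes>\<^sub>M borel)"
    by (simp_all add: borel_prod)
  have "AE x in lborel. AE y in lborel. p (x, y) = r (x, y)"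
    using assms(3) by (rule lborel_pair.AE_pair[unfolded lborel_prod])
  then have "AE y in lborel. AE x in lborel. p (x, y) = r (x, y)"
    by (subst lborel_pair.AE_commute[symmetric]) measurable
  then show ?thesis
    by (rule AE_mp) (auto simp: marginal_snd_def intro!: integral_cong_AE)
qed

text \<open>A nonpositive factor would make the integral nonpositive. This gives the sign of every
  normalising constant without computing it, so that logarithms of products can be split.\<close>

lemma factor_pos_of_integral_one:
  fixes k :: real
  assumes "has_bochner_integral M (\<lambda>x. k * e x) 1" "\<And>x. 0 \<le> e x"
  shows "0 < k"
proof (rule ccontr)
  assume "\<not> 0 < k"
  moreover have "0 \<le> (\<integral>x. e x \<partial>M)"
    using assms(2) by (intro integral_nonneg_AE) simp
  ultimately have "k * (\<integral>x. e x \<partial>M) \<le> 0"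
    by (simp add: mult_nonpos_nonneg)
  then show False using has_bochner_integral_integral_eq[OF assms(1)] by simp
qed

text \<open>The integrand of the symmetrised Kullback-Leibler divergence; both factors have the same
  sign since ln is strictly increasing.\<close>

lemma diff_mult_ln_diff_nonneg:
  fixes u v :: real
  assumes "0 < u" "0 < v"
  shows "0 \<le> (u - v) * (ln u - ln v)"
    and "(u - v) * (ln u - ln v) = 0 \<longleftrightarrow> u = v"
  using assms by (auto simp: zero_le_mult_iff ln_le_cancel_iff linear)

text \<open>Vanishing of the symmetrised divergence identifies the densities directly, so the
  parameters (m, S) and (n, K) never have to be matched with one another.\<close>

lemma gaussian_form_eq_AE:
  fixes p r :: "'a::euclidean_space \<Rightarrow> real"
  assumes "linear S" "linear K"
    and p: "has_bochner_integral lborel p 1" "AE x in lborel. p x = a * exp (- ((x - m) \<bullet> S (x - m)) / 2)"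
    and r: "has_bochner_integral lborel r 1" "AE x in lborel. r x = k * exp (- ((x - n) \<bullet> K (x - n)) / 2)"
    and se: "same_expectation p r (\<lambda>x. (x - n) \<bullet> K (x - n) - (x - m) \<bullet> S (x - m))"
  shows "AE x in lborel. p x = r x"
proof -
  note [measurable] = borel_measurable_linear[OF assms(1)] borel_measurable_linear[OF assms(2)]
    borel_measurable_has_bochner_integral[OF p(1)] borel_measurable_has_bochner_integral[OF r(1)]
  have "has_bochner_integral lborel (\<lambda>x. a * exp (- ((x - m) \<bullet> S (x - m)) / 2)) 1"
    by (rule has_bochner_integral_cong_AE[THEN iffD1, OF _ _ p(2) p(1)]) auto
  then have "0 < a" by (rule factor_pos_of_integral_one) simp
  have "has_bochner_integral lborel (\<lambda>x. k * exp (- ((x - n) \<bullet> K (x - n)) / 2)) 1"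
    by (rule has_bochner_integral_cong_AE[THEN iffD1, OF _ _ r(2) r(1)]) auto
  then have "0 < k" by (rule factor_pos_of_integral_one) simp
  \<comment> \<open>This is ln p - ln r wherever both formulas hold; as a polynomial it is given at
    every point, and its expectations are known from \<open>se\<close>.\<close>
  define h where "h x = ln a - ln k + ((x - n) \<bullet> K (x - n) - (x - m) \<bullet> S (x - m)) / 2" for x
  have "same_expectation p r (\<lambda>_. 1)"
    using p(1) r(1) by (simp add: same_expectation_def has_bochner_integral_iff)
  from same_expectation_add[OF same_expectation_cmult[OF this, of "ln a - ln k"] same_expectation_cmult[OF se, of "1 / 2"]]
  have seh: "same_expectation p r h"
    unfolding h_def[abs_def] by simp
  have int: "integrable lborel (\<lambda>x. (p x - r x) * h x)" "(\<integral>x. (p x - r x) * h x \<partial>lborel) = 0"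
    using seh by (auto simp: same_expectation_def left_diff_distrib)
  have pt: "AE x in lborel. 0 \<le> (p x - r x) * h x \<and> ((p x - r x) * h x = 0 \<longrightarrow> p x = r x)"
    using p(2) r(2)
  proof eventually_elim
    case (elim x)
    have pos: "0 < p x" "0 < r x" using elim \<open>0 < a\<close> \<open>0 < k\<close> by auto
    have "ln (p x) - ln (r x) = h x"
      unfolding elim h_def using \<open>0 < a\<close> \<open>0 < k\<close> by (simp add: ln_mult field_simps)
    with diff_mult_ln_diff_nonneg[OF pos] show ?case by simp
  qed
  then have "AE x in lborel. (p x - r x) * h x = 0"
    using integral_nonneg_eq_0_iff_AE[OF int(1)] int(2) by (simp add: eventually_conj_iff)
  with pt show ?thesis by eventually_elim blast
qed

text \<open>Extending \<open>L\<close> by 0 in the second component turns the form into a quadratic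
  form on the product.\<close>

lemma same_moments_fst_quadratic:
  fixes f g :: "'a::euclidean_space \<times> 'b::euclidean_space \<Rightarrow> real"
  assumes "same_moments \<mu> f g" "linear L"
  shows "same_expectation f g (\<lambda>z. (fst z - m) \<bullet> L (fst z - m))"
proof -
  have "linear (\<lambda>z::'a \<times> 'b. (L (fst z), 0::'b))"
    using linear_add[OF assms(2)] linear_cmul[OF assms(2)] by (intro linearI) auto
  from same_moments_quadratic_shifted[OF assms(1) this, of "(m, 0)"]
  show ?thesis by (simp add: inner_prod_def)
qed

lemma same_moments_snd_quadratic:
  fixes f g :: "'a::euclidean_space \<times> 'b::euclidean_space \<Rightarrow> real"
  assumes "same_moments \<mu> f g" "linear L"
  shows "same_expectation f g (\<lambda>z. (snd z - m) \<bullet> L (snd z - m))"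
proof -
  have "linear (\<lambda>z::'a \<times> 'b. (0::'a, L (snd z)))"
    using linear_add[OF assms(2)] linear_cmul[OF assms(2)] by (intro linearI) auto
  from same_moments_quadratic_shifted[OF assms(1) this, of "(0, m)"]
  show ?thesis by (simp add: inner_prod_def)
qed

lemma same_expectation_marginal_fst:
  fixes f g :: "'a::euclidean_space \<times> 'b::euclidean_space \<Rightarrow> real"
  assumes "same_expectation f g (\<lambda>z. h (fst z))"
  shows "same_expectation (marginal_fst f) (marginal_fst g) h"
  using assms marginal_fst_expectation[of f h] marginal_fst_expectation[of g h]
  by (simp add: same_expectation_def has_bochner_integral_iff)

text \<open>Integrating \<open>f\<close> against the indicator of the zero set of its second
  marginal gives 0. This excludes, up to a null set, the points where the mutual information
  integrand would divide a positive density by 0.\<close>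

lemma marginal_snd_eq_0_AE:
  fixes f :: "'a::euclidean_space \<times> 'b::euclidean_space \<Rightarrow> real"
  assumes "prob_density f"
  shows "AE z in lborel. marginal_snd f (snd z) = 0 \<longrightarrow> f z = 0"
proof -
  note [measurable] = prob_density_measurable[OF assms]
  have [measurable]: "f \<in> borel_measurable (borel \<Otimes>\<^sub>M borel)"
    using prob_density_measurable[OF assms] by (simp add: borel_prod)
  have int: "integrable lborel f"
    using prob_density_has_integral[OF assms] by (simp add: has_bochner_integral_iff)
  have [measurable]: "marginal_snd f \<in> borel_measurable borel"
    using has_bochner_integral_marginal_snd[OF prob_density_has_integral[OF assms]]
    by (auto dest: borel_measurable_has_bochner_integral)
  let ?h = "\<lambda>y. indicator {y. marginal_snd f y = 0} y :: real"
  have int_h: "integrable lborel (\<lambda>z. f z * ?h (snd z))"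
    by (rule Bochner_Integration.integrable_bound[OF int]) (auto simp: indicator_def borel_prod[symmetric])
  have "(\<integral>z. f z * ?h (snd z) \<partial>lborel) = (\<integral>y. marginal_snd f y * ?h y \<partial>lborel)"
    using marginal_snd_expectation[OF int_h] by (simp add: has_bochner_integral_iff)
  also have "(\<lambda>y. marginal_snd f y * ?h y) = (\<lambda>_. 0)" by (auto simp: indicator_def)
  finally have "AE z in lborel. f z * ?h (snd z) = 0"
    using integral_nonneg_eq_0_iff_AE[OF int_h] prob_density_nonneg[OF assms] by simp
  then show ?thesis by eventually_elim (auto simp: indicator_def)
qed

subsection \<open>Comparison of the mutual informations\<close>

text \<open>ln x <= x - 1 at x = (u / v) b / p. In the application p = f, b = f_Y, a = g_X, u = g
  and v = g_Y, so u / v is the conditional density of X given Y under g.\<close>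

lemma gibbs_pointwise:
  fixes p :: real
  assumes "0 \<le> p" "0 < p \<Longrightarrow> 0 < b" "0 \<le> b" "0 < a" "0 < u" "0 < v"
  shows "p * ln (u / (a * v)) + p - u / v * b \<le> p * ln (p / (a * b))"
proof (cases "p = 0")
  case True
  then show ?thesis using assms by simp
next
  case False
  then have p: "0 < p" and b: "0 < b" using assms by auto
  have "p * ln (u / v * b / p) \<le> p * (u / v * b / p - 1)"
    using p b assms by (intro mult_left_mono ln_le_minus_one) auto
  then show ?thesis
    using p b assms by (simp add: ln_mult ln_div algebra_simps)
qed

text \<open>A conditional density times a density for the conditioning variable: each fibre
  integrates to \<open>b y\<close>, and Tonelli does the rest.\<close>

lemma integral_conditional_density:
  fixes \<gamma> p :: "'a::euclidean_space \<times> 'b::euclidean_space \<Rightarrow> real"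
  assumes [measurable]: "\<gamma> \<in> borel_measurable borel" and nonneg: "\<And>z. 0 \<le> \<gamma> z"
    and pos: "\<And>y. 0 < marginal_snd \<gamma> y"
    and p: "has_bochner_integral lborel b 1" and b: "\<And>y. 0 \<le> b y"
  shows "has_bochner_integral lborel (\<lambda>z. \<gamma> z / marginal_snd \<gamma> (snd z) * b (snd z)) 1"
proof -
  have [measurable]: "\<gamma> \<in> borel_measurable (borel \<Otimes>\<^sub>M borel)" by (simp add: borel_prod)
  have [measurable]: "marginal_snd \<gamma> \<in> borel_measurable borel"
    unfolding marginal_snd_def[abs_def] by measurable
  have [measurable]: "b \<in> borel_measurable borel"
    using borel_measurable_has_bochner_integral[OF p] by simp
  have m: "(\<lambda>z. \<gamma> z / marginal_snd \<gamma> (snd z) * b (snd z)) \<in> borel_measurable (borel \<Otimes>\<^sub>M borel)"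
    by measurable
  have "(\<integral>\<^sup>+x. ennreal (\<gamma> (x, y) / marginal_snd \<gamma> y * b y) \<partial>lborel) = ennreal (b y)" for y
  proof -
    \<comment> \<open>A Bochner integral that is not 0 certifies integrability.\<close>
    have int: "integrable lborel (\<lambda>x. \<gamma> (x, y))"
      using pos[of y] not_integrable_integral_eq[of lborel "\<lambda>x. \<gamma> (x, y)"]
      by (auto simp: marginal_snd_def)
    have "(\<integral>\<^sup>+x. ennreal (\<gamma> (x, y) / marginal_snd \<gamma> y * b y) \<partial>lborel) =
        ennreal (\<integral>x. \<gamma> (x, y) / marginal_snd \<gamma> y * b y \<partial>lborel)"
      using int by (intro nn_integral_eq_integral) (auto intro!: AE_I2 mult_nonneg_nonneg divide_nonneg_pos nonneg b pos)
    also have "(\<integral>x. \<gamma> (x, y) / marginal_snd \<gamma> y * b y \<partial>lborel) = marginal_snd \<gamma> y / marginal_snd \<gamma> y * b y"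
      by (subst (2) marginal_snd_def) simp
    finally show ?thesis using pos[of y] by simp
  qed
  then have "(\<integral>\<^sup>+z. ennreal (\<gamma> z / marginal_snd \<gamma> (snd z) * b (snd z)) \<partial>(lborel \<Otimes>\<^sub>M lborel)) = (\<integral>\<^sup>+y. ennreal (b y) \<partial>lborel)"
    using m by (subst lborel_pair.nn_integral_snd[symmetric]) auto
  also have "\<dots> = 1"
    using p b by (subst nn_integral_eq_integral) (auto simp: has_bochner_integral_iff)
  finally show ?thesis
    using m by (intro has_bochner_integral_nn_integral)
      (auto simp: lborel_prod borel_prod intro!: AE_I2 mult_nonneg_nonneg divide_nonneg_pos nonneg b pos)
qed

theorem mutual_info_gauss_le:
  fixes f g :: "'a::euclidean_space \<times> 'b::euclidean_space \<Rightarrow> real"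
  assumes op: "covariance_operator A P"
    and g: "prob_density g" "AE z in lborel. g z = covariance_operator.gauss P c \<mu> z"
    and f: "prob_density f"
    and moments: "same_moments \<mu> f g"
    and fX: "linear S" "AE x in lborel. marginal_fst f x = a * exp (- ((x - m) \<bullet> S (x - m)) / 2)"
  shows "mutual_info g \<le> mutual_info f"
proof -
  interpret covariance_operator A P by fact
  note [measurable] = prob_density_measurable[OF f] prob_density_measurable[OF g(1)]
  note f_int = prob_density_has_integral[OF f] and g_int = prob_density_has_integral[OF g(1)]
  have gauss_int: "has_bochner_integral lborel (gauss c \<mu>) 1"
    by (rule has_bochner_integral_cong_AE[THEN iffD1, OF _ _ g(2) g_int]) auto
  have "0 < c"
    by (rule factor_pos_of_integral_one[OF gauss_int[unfolded gauss_def[abs_def]]]) simp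
  \<comment> \<open>Marginals of the formula rather than of \<open>g\<close>: they are positive and
    of Gaussian form at every point, whereas those of \<open>g\<close> are so only almost
    everywhere. Hence \<open>q\<close> below is a quadratic polynomial everywhere.\<close>
  define GX where "GX = marginal_fst (gauss c \<mu>)"
  define GY where "GY = marginal_snd (gauss c \<mu>)"
  obtain K k where K: "linear K" "\<And>x. GX x = k * exp (- ((x - fst \<mu>) \<bullet> K (x - fst \<mu>)) / 2)"
    using marginal_fst_gauss[OF op, of c \<mu>] unfolding GX_def by blast
  obtain L l where L: "linear L" "\<And>y. GY y = l * exp (- ((y - snd \<mu>) \<bullet> L (y - snd \<mu>)) / 2)"
    using marginal_snd_gauss[OF op, of c \<mu>] unfolding GY_def by blast
  have "0 < k"
    using has_bochner_integral_marginal_fst[OF gauss_int]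
    unfolding GX_def[symmetric] K(2)[abs_def] by (rule factor_pos_of_integral_one) simp
  have "0 < l"
    using has_bochner_integral_marginal_snd[OF gauss_int]
    unfolding GY_def[symmetric] L(2)[abs_def] by (rule factor_pos_of_integral_one) simp
  have gauss_pos: "0 < gauss c \<mu> z" and GX_pos: "0 < GX x" and GY_pos: "0 < GY y" for x y z
    using \<open>0 < c\<close> \<open>0 < k\<close> \<open>0 < l\<close> by (simp_all add: gauss_def K(2) L(2))
  have gX: "AE x in lborel. marginal_fst g x = GX x"
    unfolding GX_def by (rule marginal_fst_cong_AE) (use g(2) in auto)
  have gY: "AE y in lborel. marginal_snd g y = GY y"
    unfolding GY_def by (rule marginal_snd_cong_AE) (use g(2) in auto)
  define q where "q z = ln (gauss c \<mu> z / (GX (fst z) * GY (snd z)))" for z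
  have "q z = ln c - ln k - ln l + (- 1 / 2) * ((z - \<mu>) \<bullet> P (z - \<mu>))
      + (1 / 2) * ((fst z - fst \<mu>) \<bullet> K (fst z - fst \<mu>)) + (1 / 2) * ((snd z - snd \<mu>) \<bullet> L (snd z - snd \<mu>))" for z
    using \<open>0 < c\<close> \<open>0 < k\<close> \<open>0 < l\<close>
    by (simp add: q_def gauss_def K(2) L(2) ln_mult ln_div field_simps)
  then have "q = (\<lambda>z. ln c - ln k - ln l + (- 1 / 2) * ((z - \<mu>) \<bullet> P (z - \<mu>))
      + (1 / 2) * ((fst z - fst \<mu>) \<bullet> K (fst z - fst \<mu>)) + (1 / 2) * ((snd z - snd \<mu>) \<bullet> L (snd z - snd \<mu>)))"
    by (rule ext)
  then have q: "same_expectation f g q"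
    by (simp only:) (intro same_expectation_add same_expectation_cmult same_moments_const[OF moments]
      same_moments_quadratic[OF moments] same_moments_fst_quadratic[OF moments]
      same_moments_snd_quadratic[OF moments] linear_P K L)
  have eqX: "AE x in lborel. marginal_fst f x = GX x"
  proof -
    have "AE x in lborel. marginal_fst f x = marginal_fst g x"
    proof (rule gaussian_form_eq_AE[OF fX(1) K(1) _ fX(2), of _ k "fst \<mu>"])
      show "AE x in lborel. marginal_fst g x = k * exp (- ((x - fst \<mu>) \<bullet> K (x - fst \<mu>)) / 2)"
        using gX by (simp add: K(2))
    qed (auto intro!: has_bochner_integral_marginal_fst f_int g_int same_expectation_marginal_fst
        same_expectation_diff same_moments_fst_quadratic[OF moments] fX K)
    with gX show ?thesis by eventually_elim simp
  qed

  have "AE z in lborel. (case z of (x, y) \<Rightarrow> g (x, y) * ln (g (x, y) / (marginal_fst g x * marginal_snd g y))) = g z * q z"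
    using g(2) AE_lborel_fst[OF gX] AE_lborel_snd[OF gY]
    by eventually_elim (auto simp: q_def)
  then have "mutual_info g \<le> extended_integral lborel (\<lambda>z. g z * q z)"
    unfolding mutual_info_def by (intro extended_integral_mono_AE) (auto elim!: eventually_mono)
  also have "\<dots> = ereal (\<integral>z. f z * q z \<partial>lborel)"
    using q by (simp add: same_expectation_def extended_integral_eq_integral)
  \<comment> \<open>The two added terms each have integral 1 and cancel; with them the integrand
    lies pointwise below that of \<open>mutual_info f\<close>.\<close>
  also have "\<dots> = extended_integral lborel (\<lambda>z. f z * q z + f z - gauss c \<mu> z / GY (snd z) * marginal_snd f (snd z))"
  proof -
    have "has_bochner_integral lborel (\<lambda>z. gauss c \<mu> z / GY (snd z) * marginal_snd f (snd z)) 1"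
      unfolding GY_def
    proof (rule integral_conditional_density)
      show "0 \<le> marginal_snd f y" for y
        by (simp add: marginal_snd_def prob_density_nonneg[OF f])
    qed (intro gauss_measurable less_imp_le[OF gauss_pos] GY_pos[unfolded GY_def] has_bochner_integral_marginal_snd f_int)+
    moreover have "has_bochner_integral lborel (\<lambda>z. f z * q z) (\<integral>z. f z * q z \<partial>lborel)"
      using q by (simp add: same_expectation_def has_bochner_integral_iff)
    ultimately have "has_bochner_integral lborel (\<lambda>z. f z * q z + f z - gauss c \<mu> z / GY (snd z) * marginal_snd f (snd z))
        ((\<integral>z. f z * q z \<partial>lborel) + 1 - 1)"
      by (intro has_bochner_integral_diff has_bochner_integral_add f_int)
    then show ?thesis
      by (simp add: has_bochner_integral_iff extended_integral_eq_integral)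
  qed
  also have "\<dots> \<le> mutual_info f"
    unfolding mutual_info_def
  proof (rule extended_integral_mono_AE)
    show "AE z in lborel. f z * q z + f z - gauss c \<mu> z / GY (snd z) * marginal_snd f (snd z) \<le>
        (case z of (x, y) \<Rightarrow> f (x, y) * ln (f (x, y) / (marginal_fst f x * marginal_snd f y)))"
      using AE_lborel_fst[OF eqX] marginal_snd_eq_0_AE[OF f]
    proof eventually_elim
      case (elim z)
      have 0: "0 \<le> marginal_snd f (snd z)"
        by (simp add: marginal_snd_def prob_density_nonneg[OF f])
      have "f z * q z + f z - gauss c \<mu> z / GY (snd z) * marginal_snd f (snd z) \<le>
          f z * ln (f z / (GX (fst z) * marginal_snd f (snd z)))"
        unfolding q_def using elim 0
        by (intro gibbs_pointwise prob_density_nonneg[OF f] gauss_pos GX_pos GY_pos) auto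
      then show ?case using elim by (simp add: case_prod_beta')
    qed
  qed
  finally show ?thesis .
qed

subsection \<open>Coordinates\<close>

definition unstack :: "real ^ ('n::finite + 'm::finite) \<Rightarrow> (real ^ 'n::finite) \<times> (real ^ 'm::finite)" where
  "unstack w = (\<chi> i. w $ Inl i, \<chi> j. w $ Inr j)"

lemma unstack_stack [simp]: "unstack (stack z) = z"
  by (simp add: unstack_def stack_def prod_eq_iff vec_eq_iff)

lemma stack_unstack [simp]: "stack (unstack w) = w"
  by (auto simp: unstack_def stack_def vec_eq_iff split: sum.split)

lemma linear_stack: "linear stack"
  by (intro linearI) (auto simp: stack_def vec_eq_iff split: sum.split)

lemma linear_unstack: "linear unstack"
  by (intro linearI) (auto simp: unstack_def vec_eq_iff)

lemma inner_stack [simp]: "stack u \<bullet> stack v = u \<bullet> v"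
  by (simp add: inner_vec_def inner_prod_def stack_def UNIV_Plus_UNIV[symmetric] sum.Plus del: UNIV_Plus_UNIV)

lemma inner_unstack: "unstack w \<bullet> v = w \<bullet> stack v" "v \<bullet> unstack w = stack v \<bullet> w"
  using inner_stack[of "unstack w" v] inner_stack[of v "unstack w"] by simp_all

text \<open>Translates moments along \<open>Basis\<close> of the product space into the indexed
  coordinates of \<open>has_mean\<close> and \<open>has_covariance\<close>.\<close>

lemma stack_Basis:
  fixes i :: "(real ^ 'n) \<times> (real ^ 'm)"
  assumes "i \<in> Basis"
  obtains k where "stack i = axis k 1"
proof -
  have "stack (axis a 1, 0) = axis (Inl a) 1" "stack (0, axis b 1) = axis (Inr b) 1" for a :: 'n and b :: 'm
    by (auto simp: stack_def axis_def vec_eq_iff split: sum.split)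
  with assms that show ?thesis
    by (auto simp: Basis_prod_def Basis_vec_def)
qed

lemma covariance_operator_of_matrix:
  fixes \<Lambda> :: "real ^ ('n::finite + 'm::finite) ^ ('n + 'm)"
  assumes "pos_def_matrix \<Lambda>"
  shows "covariance_operator (\<lambda>z. unstack (\<Lambda> *v stack z)) (\<lambda>z. unstack (matrix_inv \<Lambda> *v stack z))"
proof -
  have tr: "transpose \<Lambda> = \<Lambda>" and pos: "v \<noteq> 0 \<Longrightarrow> 0 < v \<bullet> (\<Lambda> *v v)" for v
    using assms by (auto simp: pos_def_matrix_def)
  have "\<forall>x. \<Lambda> *v x = 0 \<longrightarrow> x = 0"
    using pos by (metis inner_zero_right less_irrefl)
  then have "invertible \<Lambda>"
    by (simp add: invertible_left_inverse matrix_left_invertible_ker)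
  \<comment> \<open>\<open>matrix_inv\<close> is a choice operator, so its two inverse laws are
    extracted from the existence of an inverse, which holds because the kernel is trivial.\<close>
  then have inv_eq: "\<Lambda> ** matrix_inv \<Lambda> = mat 1 \<and> matrix_inv \<Lambda> ** \<Lambda> = mat 1"
    unfolding invertible_def matrix_inv_def by (rule someI_ex)
  have lin: "linear (\<lambda>z. unstack (M *v stack z))" for M :: "real ^ ('n + 'm) ^ ('n + 'm)"
    using linear_compose[OF linear_compose[OF linear_stack matrix_vector_mul_linear[of M]] linear_unstack]
    by (simp add: o_def)
  show ?thesis
  proof (rule covariance_operator.intro)
    fix u v :: "(real ^ 'n) \<times> (real ^ 'm)"
    show "unstack (\<Lambda> *v stack u) \<bullet> v = u \<bullet> unstack (\<Lambda> *v stack v)"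
      by (metis dot_lmul_matrix inner_commute inner_unstack(1) tr transpose_matrix_vector)
    show "0 < v \<bullet> unstack (\<Lambda> *v stack v)" if "v \<noteq> 0"
    proof -
      have "stack v \<noteq> 0"
        using that linear_0[OF linear_unstack] by (metis unstack_stack)
      from pos[OF this] show ?thesis by (simp add: inner_unstack)
    qed
  qed (simp_all add: lin matrix_vector_mul_assoc inv_eq)
qed

lemma mvn_density_stack:
  fixes \<Lambda> :: "real ^ ('n::finite + 'm::finite) ^ ('n + 'm)"
  assumes "pos_def_matrix \<Lambda>"
  shows "mvn_density \<mu> \<Lambda> (stack z) =
    covariance_operator.gauss (\<lambda>z. unstack (matrix_inv \<Lambda> *v stack z))
      (1 / sqrt ((2 * pi) ^ CARD('n + 'm) * det \<Lambda>)) (unstack \<mu>) z"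
proof -
  have "stack z - \<mu> = stack (z - unstack \<mu>)"
    by (simp add: linear_diff[OF linear_stack])
  then show ?thesis
    unfolding covariance_operator.gauss_def[OF covariance_operator_of_matrix[OF assms]] mvn_density_def
    by (simp add: inner_unstack)
qed

theorem proposition1:
  fixes f g :: "(real ^ 'n) \<times> (real ^ 'm) \<Rightarrow> real"
    and \<mu> :: "real ^ ('n + 'm)"
    and \<Lambda> :: "real ^ ('n + 'm) ^ ('n + 'm)"
  assumes "pos_def_matrix \<Lambda>"
    and "prob_density g"
    and "AE z in lborel. g z = mvn_density \<mu> \<Lambda> (stack z)"
    and "prob_density f"
    and "has_mean f \<mu>"
    and "has_covariance f \<mu> \<Lambda>"
    and "gaussian_density (marginal_fst f)"
  shows "mutual_info f \<ge> mutual_info g"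
proof -
  define A where "A = (\<lambda>z::(real ^ 'n) \<times> (real ^ 'm). unstack (\<Lambda> *v stack z))"
  define P where "P = (\<lambda>z::(real ^ 'n) \<times> (real ^ 'm). unstack (matrix_inv \<Lambda> *v stack z))"
  define c where "c = 1 / sqrt ((2 * pi) ^ CARD('n + 'm) * det \<Lambda>)"
  define \<nu> where "\<nu> = unstack \<mu>"
  have op: "covariance_operator A P"
    unfolding A_def P_def by (rule covariance_operator_of_matrix) fact
  interpret covariance_operator A P by fact
  have g_eq: "AE z in lborel. g z = gauss c \<nu> z"
    using assms(3) by (simp add: mvn_density_stack[OF assms(1)] P_def c_def \<nu>_def)
  note [measurable] = prob_density_measurable[OF assms(2)]
  note f_int = prob_density_has_integral[OF assms(4)] and g_int = prob_density_has_integral[OF assms(2)]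
  have gauss_int: "has_bochner_integral lborel (gauss c \<nu>) 1"
    by (rule has_bochner_integral_cong_AE[THEN iffD1, OF _ _ g_eq g_int]) auto
  have transfer: "has_bochner_integral lborel (\<lambda>z. g z * h z) r"
    if "has_bochner_integral lborel (\<lambda>z. gauss c \<nu> z * h z) r" "h \<in> borel_measurable borel" for h r
    using that(2) g_eq
    by (intro has_bochner_integral_cong_AE[THEN iffD1, OF _ _ _ that(1)]) (auto elim!: eventually_mono)
  have coord: "(z - \<nu>) \<bullet> i = stack z $ k - \<mu> $ k" if "stack i = axis k 1" for z i k
  proof -
    have "(z - \<nu>) \<bullet> i = stack (z - \<nu>) \<bullet> stack i" by simp
    also have "\<dots> = (stack z - \<mu>) \<bullet> axis k 1"
      unfolding that by (simp add: linear_diff[OF linear_stack] \<nu>_def)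
    finally show ?thesis by (simp add: inner_axis)
  qed
  have same: "same_expectation f g h"
    if "has_bochner_integral lborel (\<lambda>z. f z * h z) r" "has_bochner_integral lborel (\<lambda>z. g z * h z) r" for h r
    using that by (simp add: same_expectation_def has_bochner_integral_iff)
  have moments: "same_moments \<nu> f g"
    unfolding same_moments_def
  proof (intro conjI ballI)
    show "same_expectation f g (\<lambda>_. 1)"
      using f_int g_int by (intro same) auto
  next
    fix i :: "(real ^ 'n) \<times> (real ^ 'm)" assume i: "i \<in> Basis"
    then obtain k where k: "stack i = axis k 1" by (rule stack_Basis)
    \<comment> \<open>The mean hypothesis concerns uncentred coordinates; subtracting the k-th mean
      times the total mass 1 of \<open>f\<close> centres it.\<close>
    have "has_bochner_integral lborel (\<lambda>z. (f z *\<^sub>R stack z) \<bullet> axis k 1 - f z * \<mu> $ k) (\<mu> \<bullet> axis k 1 - 1 * \<mu> $ k)"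
      using assms(5) unfolding has_mean_def
      by (intro has_bochner_integral_diff has_bochner_integral_inner_left has_bochner_integral_mult_left f_int)
    then have "has_bochner_integral lborel (\<lambda>z. f z * ((z - \<nu>) \<bullet> i)) 0"
      by (simp add: coord[OF k] inner_axis right_diff_distrib)
    then show "same_expectation f g (\<lambda>z. (z - \<nu>) \<bullet> i)"
      by (rule same) (auto intro!: transfer gauss_mean gauss_int)
    fix j :: "(real ^ 'n) \<times> (real ^ 'm)" assume j: "j \<in> Basis"
    then obtain l where l: "stack j = axis l 1" by (rule stack_Basis)
    \<comment> \<open>Identifies the covariance prescribed for \<open>f\<close> with the value that
      \<open>gauss_covariance\<close> gives for the Gaussian.\<close>
    have "i \<bullet> A j = \<Lambda> $ k $ l"
      by (simp add: A_def inner_unstack k l matrix_vector_mult_basis inner_axis' column_def)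
    then have "has_bochner_integral lborel (\<lambda>z. f z * (((z - \<nu>) \<bullet> i) * ((z - \<nu>) \<bullet> j))) (i \<bullet> A j)"
      using assms(6) by (simp add: coord[OF k] coord[OF l] has_covariance_def)
    then show "same_expectation f g (\<lambda>z. ((z - \<nu>) \<bullet> i) * ((z - \<nu>) \<bullet> j))"
      by (rule same) (auto intro!: transfer gauss_covariance gauss_int)
  qed
  obtain m S where "AE x in lborel. marginal_fst f x = mvn_density m S x"
    using assms(7) by (auto simp: gaussian_density_def)
  then have "AE x in lborel. marginal_fst f x =
      1 / sqrt ((2 * pi) ^ CARD('n) * det S) * exp (- ((x - m) \<bullet> (matrix_inv S *v (x - m))) / 2)"
    by (simp add: mvn_density_def)
  from mutual_info_gauss_le[OF op assms(2) g_eq assms(4) moments matrix_vector_mul_linear this]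
  show ?thesis .
qed

end
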